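(* Let $\mu$ be a probability measure on $\mathbb{R}$ with bounded connected support $[a,b]$, $a<b$, possibly with a finite number of atoms, and let $F$ be its c.d.f. For $n\ge1$ let $x_k=a+\frac{b-a}{n}k$, $0\le k\le n$, be the uniform mesh of $[a,b]$ and let $$\mu_n=F(a)\,\delta_a+\sum_{k=1}^{n}\big(F(x_k)-F(x_{k-1})\big)\,\delta_{x_k}.$$ Let $G$ and $G_n$ be the analytic functions on the unit disc $\mathbb{D}$ generated by $\mu$ and $\mu_n$ through Gross' construction. Then for every $p>1$, $$\|G_n-G\|_{\mathbf{H}^p(\mathbb{D})}=O\!\left(\tfrac1n\right)\quad\text{as } n\to\infty.$$
   Context: For a probability measure $\nu$ on $\mathbb{R}$ with c.d.f. $F_\nu(x)=\nu((-\infty,x])$, its quantile function is $q_\nu(u)=\inf\{x: F_\nu(x)\ge u\}$, $u\in(0,1)$. Gross' construction: if $\nu$ has finite first moment, put $\varphi_\nu(\theta)=q_\nu(|\theta|/\pi)$ for $\theta\in(-\pi,\pi)$, let $a_k(\nu)=\frac{2}{\pi}\int_0^{\pi} q_\nu(\theta/\pi)\cos(k\theta)\,d\theta$ ($k\ge1$) be its Fourier cosine coefficients, and define $G_\nu(z)=\sum_{k=1}^{\infty}a_k(\nu)z^k$ for $z\in\mathbb{D}=\{|z|<1\}$. In the claim $G=G_\mu$ and $G_n=G_{\mu_n}$. For $f$ analytic on $\mathbb{D}$, $\|f\|_{\mathbf{H}^p(\mathbb{D})}=\sup_{0\le r<1}\left(\frac{1}{2\pi}\int_0^{2\pi}|f(re^{i\theta})|^p\,d\theta\right)^{1/p}$.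 The symbol $\delta_x$ denotes the Dirac mass at $x$. *)

theory Defs
  imports "HOL-Probability.Probability" "HOL-Library.Landau_Symbols"
begin

definition measure_support :: "real measure \<Rightarrow> real set" where
  "measure_support M = {x. \<forall>U. open U \<longrightarrow> x \<in> U \<longrightarrow> emeasure M U > 0}"

definition atoms :: "real measure \<Rightarrow> real set" where
  "atoms M = {x. emeasure M {x} > 0}"

text \<open>For a probability measure, only the values at \<open>0 < u < 1\<close> are meaningful.\<close>

definition quantile :: "real measure \<Rightarrow> real \<Rightarrow> real" where
  "quantile M u = Inf {x. u \<le> cdf M x}"

text \<open>The interval integral is over the open interval \<open>(0, pi)\<close>, so the quantile function is
  used only on \<open>(0, 1)\<close>.\<close>

definition gross_coeff :: "real measure \<Rightarrow> nat \<Rightarrow> real" where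
  "gross_coeff M k = 2 / pi * (LBINT \<theta>=0..pi. quantile M (\<theta> / pi) * cos (real k * \<theta>))"

text \<open>The series starts at exponent 1; it converges for \<open>norm z < 1\<close> when \<open>M\<close> has a finite
  first moment, since the coefficients are then bounded.\<close>

definition gross :: "real measure \<Rightarrow> complex \<Rightarrow> complex" where
  "gross M z = (\<Sum>k. of_real (gross_coeff M (Suc k)) * z ^ Suc k)"

text \<open>Meant for \<open>f\<close> analytic on the open unit disc: each circular mean is then a genuine real
  number, and the supremum is taken in the extended nonnegative reals, with value \<open>\<infinity>\<close> exactly
  when \<open>f\<close> is not in the Hardy space.\<close>

definition hardy_norm :: "real \<Rightarrow> (complex \<Rightarrow> complex) \<Rightarrow> ennreal" where
  "hardy_norm p f = (SUP r\<in>{0..<1::real}.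
     ennreal ((1 / (2 * pi) *
       (LBINT \<theta>=0..2*pi. norm (f (of_real r * exp (\<i> * of_real \<theta>))) powr p)) powr (1 / p)))"

definition mesh :: "real \<Rightarrow> real \<Rightarrow> nat \<Rightarrow> nat \<Rightarrow> real" where
  "mesh a b n k = a + (b - a) / real n * real k"

text \<open>\<open>return borel x\<close> is the Dirac mass at \<open>x\<close>. The set function below is countably additive
  (\<open>emeasure_discretize\<close>), so \<open>measure_of\<close> does not fall back to the zero measure.\<close>

definition discretize :: "real \<Rightarrow> real \<Rightarrow> nat \<Rightarrow> real measure \<Rightarrow> real measure" where
  "discretize a b n M = measure_of UNIV (sets borel) (\<lambda>A.
     ennreal (cdf M a) * emeasure (return borel a) A +
     (\<Sum>k=1..n. ennreal (cdf M (mesh a b n k) - cdf M (mesh a b n (k - 1))) *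
       emeasure (return borel (mesh a b n k)) A))"

lemma sets_discretize [simp, measurable_cong]: "sets (discretize a b n M) = sets borel"
  using sets.sigma_sets_eq[of "borel :: real measure"]
  by (simp add: discretize_def)

lemma space_discretize [simp]: "space (discretize a b n M) = UNIV"
  by (simp add: discretize_def)

lemma emeasure_discretize:
  assumes A: "A \<in> sets borel"
  shows "emeasure (discretize a b n M) A =
     ennreal (cdf M a) * emeasure (return borel a) A +
     (\<Sum>k=1..n. ennreal (cdf M (mesh a b n k) - cdf M (mesh a b n (k - 1))) *
       emeasure (return borel (mesh a b n k)) A)"
proof (rule emeasure_measure_of[OF discretize_def])
  have ca: "(\<Sum>i. emeasure (return borel x) (B i)) = emeasure (return borel x) (\<Union>i. B i)"
    if "range B \<subseteq> sets borel" "disjoint_family B" for B :: "nat \<Rightarrow> real set" and x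
    using that by (intro suminf_emeasure) auto
  show "countably_additive (sets (discretize a b n M)) (\<lambda>A.
     ennreal (cdf M a) * emeasure (return borel a) A +
     (\<Sum>k=1..n. ennreal (cdf M (mesh a b n k) - cdf M (mesh a b n (k - 1))) *
       emeasure (return borel (mesh a b n k)) A))"
    unfolding countably_additive_def
    by (auto simp: suminf_add[symmetric] suminf_sum ca summableI simp del: emeasure_return)
qed (use A in \<open>auto simp: positive_def\<close>)

end

theory Submission
  imports Defs "HOL-Complex_Analysis.Complex_Analysis"
begin

text \<open>The c.d.f. \<open>F\<^sub>n\<close> of the discretization satisfies \<open>F (x - d) \<le> F\<^sub>n x \<le> F x\<close> with
  \<open>d = (b - a) / n\<close>, so the quantile functions differ by at most \<open>d\<close> everywhere on \<open>(0, 1)\<close>.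
  Hence \<open>G\<^sub>n - G\<close> is the analytic function attached to a cosine series of a function bounded by \<open>d\<close>,
  and positivity of the Poisson kernel gives \<open>\<bar>Re (G\<^sub>n - G)\<bar> \<le> 2 * d\<close>. The M. Riesz theorem is not
  needed in full: since the real part is bounded, the mean value property of \<open>cos ((G\<^sub>n - G) / (2 * d))\<close>
  controls the exponential moments of the imaginary part, and with them all circular \<open>p\<close>-means.\<close>

section \<open>Mesh discretization and quantiles\<close>

text \<open>Every point off the support has a null open neighbourhood, and by the Lindelof property
  countably many of these cover \<open>S\<close>.\<close>

lemma (in real_distribution) null_sets_outside_support:
  assumes "S \<in> sets borel" "S \<inter> measure_support M = {}"
  shows "S \<in> null_sets M"
proof -
  have "\<exists>U. open U \<and> y \<in> U \<and> emeasure M U = 0" if "y \<in> S" for y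
  proof -
    have "y \<notin> measure_support M"
      using assms that by auto
    then show ?thesis
      by (simp add: measure_support_def)
  qed
  then obtain U where U: "\<And>y. y \<in> S \<Longrightarrow> open (U y) \<and> y \<in> U y \<and> emeasure M (U y) = 0"
    by metis
  obtain D where D: "D \<subseteq> U ` S" "countable D" "\<Union>D = \<Union>(U ` S)"
    using Lindelof[of "U ` S"] U by blast
  have "(\<Union>V\<in>D. V) \<in> null_sets M"
  proof (rule null_sets_UN'[OF D(2)])
    show "V \<in> null_sets M" if "V \<in> D" for V
      using D(1) U that by (auto intro!: null_setsI)
  qed
  moreover have "S \<subseteq> (\<Union>V\<in>D. V)"
    using D(3) U by auto
  ultimately show ?thesis
    using assms(1) by (auto intro: null_sets_subset)
qed

lemma (in real_distribution) cdf_eq_0_below_support: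
  assumes "measure_support M \<subseteq> {a..}" "x < a"
  shows "cdf M x = 0"
proof -
  have "{..x} \<in> null_sets M"
    using assms by (intro null_sets_outside_support) auto
  then show ?thesis
    by (simp add: cdf_def null_sets_def measure_def)
qed

lemma (in real_distribution) cdf_eq_1_above_support:
  assumes "measure_support M \<subseteq> {..b}" "b \<le> x"
  shows "cdf M x = 1"
proof -
  have "{x<..} \<in> null_sets M"
    using assms by (intro null_sets_outside_support) auto
  then have "measure M {x<..} = 0"
    by (simp add: null_sets_def measure_def)
  moreover have "{x<..} = space M - {..x}"
    by auto
  ultimately show ?thesis
    using prob_compl[of "{..x}"] by (simp add: cdf_def)
qed

text \<open>The weights telescope: the mass at \<open>a = mesh a b n 0\<close> and the first
  \<open>m\<close> increments add up to the c.d.f. at the mesh point of index \<open>m\<close>. The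
  index is a parameter since it is a floor in one use and \<open>n\<close> in another.\<close>

lemma (in finite_borel_measure) cdf_discretize:
  assumes "a < b" "n > 0" "a \<le> x" and m: "m \<le> n" "\<And>k. k \<in> {1..n} \<Longrightarrow> mesh a b n k \<le> x \<longleftrightarrow> k \<le> m"
  shows "cdf (discretize a b n M) x = cdf M (mesh a b n m)"
proof -
  let ?F = "\<lambda>k. cdf M (mesh a b n k)"
  have mono: "?F (k - 1) \<le> ?F k" for k
    using assms by (intro cdf_nondecreasing) (simp add: mesh_def divide_right_mono mult_left_mono)
  have tele: "(\<Sum>k=1..m. ?F k - ?F (k - 1)) = ?F m - ?F 0"
    by (induction m) auto
  have "(\<Sum>k=1..n. ennreal (?F k - ?F (k - 1)) * emeasure (return borel (mesh a b n k)) {..x})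
      = (\<Sum>k=1..n. if k \<le> m then ennreal (?F k - ?F (k - 1)) else 0)"
    using m(2) by (intro sum.cong) (auto split: split_indicator)
  also have "\<dots> = (\<Sum>k\<in>{1..m}. ennreal (?F k - ?F (k - 1)))"
    using m(1) by (intro sum.mono_neutral_cong_right) auto
  also have "\<dots> = ennreal (\<Sum>k=1..m. ?F k - ?F (k - 1))"
    using mono by (intro sum_ennreal) simp
  also have "\<dots> = ennreal (?F m - ?F 0)"
    by (simp only: tele)
  finally have "emeasure (discretize a b n M) {..x} = ennreal (cdf M a) + ennreal (?F m - ?F 0)"
    using \<open>a \<le> x\<close> by (subst emeasure_discretize) auto
  also have "\<dots> = ennreal (?F m)"
    using assms cdf_nondecreasing[of "mesh a b n 0" "mesh a b n m"]
    by (subst ennreal_plus[symmetric]) (auto simp: cdf_nonneg mesh_def)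
  finally show ?thesis
    by (simp add: cdf_def measure_def)
qed

text \<open>For \<open>x\<close> in \<open>{a..b}\<close> the discretization evaluates the c.d.f. at
  the last mesh point up to \<open>x\<close>, less than one mesh width to the left. Left of
  \<open>a\<close> it vanishes, as does the lower bound; right of \<open>b\<close> it is 1.\<close>

lemma (in real_distribution) cdf_discretize_bounds:
  assumes "a < b" "n > 0" and supp: "measure_support M \<subseteq> {a..b}"
  shows "cdf (discretize a b n M) x \<le> cdf M x"
    and "cdf M (x - (b - a) / real n) \<le> cdf (discretize a b n M) x"
proof -
  define d where "d = (b - a) / real n"
  have d: "d > 0" "real n * d = b - a"
    using assms by (auto simp: d_def)
  have mesh: "mesh a b n k = a + d * real k" for k
    by (simp add: mesh_def d_def)
  have "cdf (discretize a b n M) x \<le> cdf M x \<and> cdf M (x - d) \<le> cdf (discretize a b n M) x"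
  proof (cases "a \<le> x")
    case False
    have "mesh a b n k > x" for k
    proof -
      have "0 \<le> d * real k"
        using d by simp
      then show ?thesis
        using False unfolding mesh by linarith
    qed
    then have "emeasure (discretize a b n M) {..x} = 0"
      using False by (subst emeasure_discretize) (auto split: split_indicator simp: not_le)
    then have "cdf (discretize a b n M) x = 0"
      by (simp add: cdf_def measure_def)
    moreover have "cdf M (x - d) = 0"
      using False d supp by (intro cdf_eq_0_below_support[of a]) auto
    ultimately show ?thesis
      by (simp add: cdf_nonneg)
  next
    case True
    \<comment> \<open>This is the index of the last mesh point up to \<open>x\<close>, capped at
      \<open>n\<close> when \<open>x\<close> lies beyond \<open>b\<close>. Since
      \<open>a \<le> x\<close>, the floor is nonnegative and \<open>nat\<close> does not change
      it.\<close>
    define m where "m = min n (nat \<lfloor>(x - a) / d\<rfloor>)"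
    have le: "mesh a b n k \<le> x \<longleftrightarrow> k \<le> m" if "k \<in> {1..n}" for k
    proof -
      have "mesh a b n k \<le> x \<longleftrightarrow> real k \<le> (x - a) / d"
        using d by (simp add: mesh field_simps)
      also have "\<dots> \<longleftrightarrow> k \<le> nat \<lfloor>(x - a) / d\<rfloor>"
        using True d by (simp add: le_nat_iff le_floor_iff)
      finally show ?thesis
        using that by (simp add: m_def)
    qed
    have F: "cdf (discretize a b n M) x = cdf M (mesh a b n m)"
      using assms True le by (intro cdf_discretize) (auto simp: m_def)
    \<comment> \<open>The equivalence \<open>le\<close> starts at index 1; index 0 is the point
      \<open>a\<close> itself.\<close>
    have "mesh a b n m \<le> x"
    proof (cases "m = 0")
      case True
      then show ?thesis
        using \<open>a \<le> x\<close> by (simp add: mesh)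
    next
      case False
      moreover have "m \<le> n"
        by (simp add: m_def)
      ultimately show ?thesis
        using le[of m] by simp
    qed
    \<comment> \<open>Either the last mesh point is \<open>b\<close>, where the c.d.f. has reached
      1, or the next mesh point exceeds \<open>x\<close>.\<close>
    moreover have "cdf M (x - d) \<le> cdf M (mesh a b n m)"
    proof (cases "m = n")
      case True
      then have "mesh a b n m = b"
        using d by (simp add: mesh mult.commute)
      then have "cdf M (mesh a b n m) = 1"
        using supp by (intro cdf_eq_1_above_support[of b]) auto
      then show ?thesis
        using cdf_bounded_prob by simp
    next
      case False
      then have "\<not> mesh a b n (Suc m) \<le> x"
        using le[of "Suc m"] by (auto simp: m_def)
      then show ?thesis
        by (intro cdf_nondecreasing) (simp add: mesh algebra_simps)
    qed
    ultimately show ?thesis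
      by (simp add: F cdf_nondecreasing)
  qed
  then show "cdf (discretize a b n M) x \<le> cdf M x"
    "cdf M (x - (b - a) / real n) \<le> cdf (discretize a b n M) x"
    by (auto simp: d_def)
qed

section \<open>Comparison of quantile functions\<close>

context
  fixes M :: "real measure" and a b :: real
  assumes cdf_low: "\<forall>x<a. cdf M x = 0" and cdf_high: "1 \<le> cdf M b"
begin

text \<open>These two facts give the infimum in \<open>quantile\<close> its usual meaning instead of
  an unspecified value. The context assumes only the behaviour of the c.d.f. at the two ends, so it
  applies to a measure and to its discretization alike.\<close>

lemma quantile_set:
  assumes "0 < u" "u < 1"
  shows "b \<in> {x. u \<le> cdf M x}" "bdd_below {x. u \<le> cdf M x}"
proof -
  show "b \<in> {x. u \<le> cdf M x}"
    using cdf_high assms by simp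
  show "bdd_below {x. u \<le> cdf M x}"
  proof (rule bdd_belowI[of _ a])
    show "a \<le> x" if "x \<in> {x. u \<le> cdf M x}" for x
      using that cdf_low assms by (cases "x < a") auto
  qed
qed

lemma quantile_in_interval:
  assumes "0 < u" "u < 1"
  shows "quantile M u \<in> {a..b}"
proof -
  have "a \<le> quantile M u"
    unfolding quantile_def
  proof (rule cInf_greatest)
    show "{x. u \<le> cdf M x} \<noteq> {}"
      using quantile_set[OF assms] by blast
    show "a \<le> x" if "x \<in> {x. u \<le> cdf M x}" for x
      using that cdf_low assms by (cases "x < a") auto
  qed
  moreover have "quantile M u \<le> b"
    unfolding quantile_def using quantile_set[OF assms] by (intro cInf_lower)
  ultimately show ?thesis
    by simp
qed

text \<open>Monotonicity will supply Borel measurability.\<close>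

lemma quantile_mono_on: "mono_on {0<..<1} (quantile M)"
proof (rule mono_onI)
  fix u v :: real
  assume "u \<in> {0<..<1}" "v \<in> {0<..<1}" "u \<le> v"
  then show "quantile M u \<le> quantile M v"
    unfolding quantile_def using quantile_set[of u] quantile_set[of v]
    by (intro cInf_superset_mono) auto
qed

end

text \<open>The set whose infimum is \<open>quantile N u\<close> is contained in that for
  \<open>M\<close>, and it contains the set for \<open>M\<close> translated by
  \<open>d\<close>.\<close>

lemma quantile_shift_bounds:
  assumes M: "\<forall>x<a. cdf M x = 0" "1 \<le> cdf M b"
    and N: "\<forall>x<a. cdf N x = 0" "1 \<le> cdf N b"
    and le: "\<And>x. cdf N x \<le> cdf M x" and ge: "\<And>x. cdf M (x - d) \<le> cdf N x"
    and u: "0 < u" "u < 1"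
  shows "quantile M u \<le> quantile N u" "quantile N u \<le> quantile M u + d"
proof -
  show "quantile M u \<le> quantile N u"
    unfolding quantile_def using quantile_set[OF M u] quantile_set[OF N u] le
    by (intro cInf_superset_mono) (auto intro: order_trans)
  have "quantile N u - d \<le> quantile M u"
    unfolding quantile_def[of M]
  proof (rule cInf_greatest)
    show "{x. u \<le> cdf M x} \<noteq> {}"
      using quantile_set[OF M u] by blast
    fix x assume "x \<in> {x. u \<le> cdf M x}"
    then have "x + d \<in> {x. u \<le> cdf N x}"
      using ge[of "x + d"] by simp
    then have "quantile N u \<le> x + d"
      unfolding quantile_def using quantile_set[OF N u] by (intro cInf_lower)
    then show "quantile N u - d \<le> x"
      by simp
  qed
  then show "quantile N u \<le> quantile M u + d"
    by simp
qed

section \<open>Cosine series of bounded functions\<close>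

text \<open>The upper half circle, parametrised by the angle. Being a finite measure, it makes
  bounded measurable functions integrable, and the open interval keeps \<open>\<theta> / pi\<close>
  inside \<open>(0, 1)\<close>.\<close>

definition upper_arc :: "real measure" where
  "upper_arc = restrict_space lborel {0<..<pi}"

lemma space_upper_arc [simp]: "space upper_arc = {0<..<pi}"
  by (simp add: upper_arc_def space_restrict_space)

lemma sets_upper_arc [measurable_cong]: "sets upper_arc = sets (restrict_space borel {0<..<pi})"
  unfolding upper_arc_def by (intro sets_restrict_space_cong) simp

lemma measure_upper_arc: "measure upper_arc {0<..<pi} = pi"
  by (simp add: upper_arc_def measure_restrict_space)

interpretation upper_arc: finite_measure upper_arc
  by standard (simp add: upper_arc_def emeasure_restrict_space)

lemma measurable_upper_arcI: "f \<in> borel_measurable borel \<Longrightarrow> f \<in> borel_measurable upper_arc"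
  unfolding upper_arc_def by (intro measurable_restrict_space1) simp

lemma LBINT_eq_integral_upper_arc:
  fixes f :: "real \<Rightarrow> 'a :: {banach, second_countable_topology}"
  shows "(LBINT \<theta>=0..pi. f \<theta>) = integral\<^sup>L upper_arc f"
  by (simp add: zero_ereal_def interval_lebesgue_integral_le_eq upper_arc_def integral_restrict_space
      set_lebesgue_integral_def)

text \<open>Its real part plus 1/2 is one quarter of the sum of the Poisson kernels
  \<open>Re ((1 + w) / (1 - w))\<close> at \<open>w = z * cis \<theta>\<close> and
  \<open>w = z * cis (-\<theta>)\<close>.\<close>

definition cos_kernel :: "complex \<Rightarrow> real \<Rightarrow> complex" where
  "cos_kernel z \<theta> = (\<Sum>k. of_real (cos (real (Suc k) * \<theta>)) * z ^ Suc k)"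

lemma cos_kernel_sums:
  assumes "norm z < 1"
  shows "(\<lambda>k. of_real (cos (real (Suc k) * \<theta>)) * z ^ Suc k) sums cos_kernel z \<theta>"
proof -
  have "summable (\<lambda>k. of_real (cos (real (Suc k) * \<theta>)) * z ^ Suc k)"
  proof (rule summable_comparison_test')
    show "summable (\<lambda>k. norm z ^ Suc k)"
      using assms by (simp add: summable_Suc_iff summable_geometric)
    show "norm (of_real (cos (real (Suc k) * \<theta>)) * z ^ Suc k) \<le> norm z ^ Suc k" if "k \<ge> 0" for k
      using mult_right_mono[OF abs_cos_le_one[of "real (Suc k) * \<theta>"], of "norm (z ^ Suc k)"]
      by (simp add: norm_mult norm_power)
  qed
  then show ?thesis
    by (simp add: cos_kernel_def summable_sums)
qed

text \<open>Writing the cosine as the mean of two exponentials splits the series into two geometric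
  series.\<close>

lemma cos_kernel_eq:
  assumes "norm z < 1"
  shows "cos_kernel z \<theta> =
    (z * cis \<theta> / (1 - z * cis \<theta>) + z * cis (-\<theta>) / (1 - z * cis (-\<theta>))) / 2"
proof -
  have "(\<lambda>k. (z * cis t) ^ Suc k) sums (z * cis t / (1 - z * cis t))" for t
    using sums_mult[OF geometric_sums[of "z * cis t"], of "z * cis t"] assms
    by (simp add: norm_mult)
  from sums_divide[OF sums_add[OF this[of \<theta>] this[of "-\<theta>"]], of 2]
  have "(\<lambda>k. of_real (cos (real (Suc k) * \<theta>)) * z ^ Suc k) sums
    ((z * cis \<theta> / (1 - z * cis \<theta>) + z * cis (-\<theta>) / (1 - z * cis (-\<theta>))) / 2)"
  proof (rule sums_cong[THEN iffD1, rotated])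
    fix k
    have "cis (real (Suc k) * \<theta>) + cis (- (real (Suc k) * \<theta>)) = 2 * of_real (cos (real (Suc k) * \<theta>))"
      by (simp add: complex_eq_iff)
    then show "((z * cis \<theta>) ^ Suc k + (z * cis (-\<theta>)) ^ Suc k) / 2 =
        of_real (cos (real (Suc k) * \<theta>)) * z ^ Suc k"
      by (simp add: power_mult_distrib Complex.DeMoivre ring_distribs[symmetric] del: power_Suc of_nat_Suc)
  qed
  with cos_kernel_sums[OF assms] show ?thesis
    by (rule sums_unique2)
qed

text \<open>Positivity of the Poisson kernel: the Moebius map \<open>w / (1 - w)\<close> sends the
  unit disc into the half plane to the right of -1/2, and the kernel is a mean of two of its
  values.\<close>

lemma Re_cos_kernel_ge:
  assumes "norm z < 1"
  shows "- 1 / 2 \<le> Re (cos_kernel z \<theta>)"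
proof -
  have S: "- 1 / 2 \<le> Re (w / (1 - w))" if "norm w < 1" for w :: complex
  proof -
    have "w \<noteq> 1"
      using that by auto
    then have pos: "(1 - Re w)\<^sup>2 + (Im w)\<^sup>2 > 0"
      by (auto simp: complex_eq_iff sum_power2_gt_zero_iff)
    have "(Re w)\<^sup>2 + (Im w)\<^sup>2 \<le> 1"
      using that power_mono[of "norm w" 1 2] by (simp add: cmod_power2)
    then show ?thesis
      using pos by (simp add: Re_divide field_simps power2_eq_square)
  qed
  have "norm (z * cis t) < 1" for t
    using assms by (simp add: norm_mult)
  from S[OF this[of \<theta>]] S[OF this[of "-\<theta>"]] show ?thesis
    using assms by (simp add: cos_kernel_eq)
qed

text \<open>Integral form of Gross' series, with the factor of \<open>gross_coeff\<close>. It is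
  linear in \<open>h\<close>, so a difference of two Gross functions is the transform of a
  difference of quantiles.\<close>

definition cos_transform :: "(real \<Rightarrow> real) \<Rightarrow> complex \<Rightarrow> complex" where
  "cos_transform h z = 2 / pi * (\<integral>\<theta>. of_real (h \<theta>) * cos_kernel z \<theta> \<partial>upper_arc)"

context
  fixes h :: "real \<Rightarrow> real" and B :: real
  assumes h_meas [measurable]: "h \<in> borel_measurable upper_arc"
    and h_bound: "\<And>\<theta>. \<theta> \<in> {0<..<pi} \<Longrightarrow> \<bar>h \<theta>\<bar> \<le> B"
begin

lemma integrable_mult_cos:
  "integrable upper_arc (\<lambda>\<theta>. h \<theta> * cos (c * \<theta>))"
proof -
  have [measurable]: "(\<lambda>\<theta>. cos (c * \<theta>)) \<in> borel_measurable upper_arc"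
    by (intro measurable_upper_arcI) simp
  show "integrable upper_arc (\<lambda>\<theta>. h \<theta> * cos (c * \<theta>))"
  proof (rule upper_arc.integrable_const_bound[where B = B])
    show "AE \<theta> in upper_arc. norm (h \<theta> * cos (c * \<theta>)) \<le> B"
    proof (rule AE_I2)
      fix \<theta> assume "\<theta> \<in> space upper_arc"
      then show "norm (h \<theta> * cos (c * \<theta>)) \<le> B"
        using mult_mono[OF h_bound[of \<theta>] abs_cos_le_one[of "c * \<theta>"]] h_bound[of \<theta>]
        by (simp add: abs_mult)
    qed
  qed measurable
qed

text \<open>The terms are dominated by \<open>B * norm z ^ Suc k\<close>, a summable bound on a
  finite measure, so sum and integral can be exchanged.\<close>

lemma cos_kernel_integral:
  assumes z: "norm z < 1"
  shows "integrable upper_arc (\<lambda>\<theta>. of_real (h \<theta>) * cos_kernel z \<theta>)"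
    and "(\<lambda>k. of_real (\<integral>\<theta>. h \<theta> * cos (real (Suc k) * \<theta>) \<partial>upper_arc) * z ^ Suc k) sums
      (\<integral>\<theta>. of_real (h \<theta>) * cos_kernel z \<theta> \<partial>upper_arc)"
proof -
  define f where "f k \<theta> = of_real (h \<theta> * cos (real (Suc k) * \<theta>)) * z ^ Suc k" for k \<theta>
  have int: "integrable upper_arc (f k)" for k
    unfolding f_def by (intro integrable_mult_left integrable_of_real integrable_mult_cos)
  have bound: "norm (f k \<theta>) \<le> B * norm z ^ Suc k" if "\<theta> \<in> {0<..<pi}" for k \<theta>
  proof -
    have "\<bar>h \<theta> * cos (real (Suc k) * \<theta>)\<bar> \<le> B * 1"
      unfolding abs_mult using h_bound[OF that] by (intro mult_mono) auto
    then have "\<bar>h \<theta> * cos (real (Suc k) * \<theta>)\<bar> * norm z ^ Suc k \<le> B * norm z ^ Suc k"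
      by (intro mult_right_mono) auto
    then show ?thesis
      by (simp only: f_def norm_mult norm_of_real norm_power)
  qed
  have summ: "summable (\<lambda>k. c * norm z ^ Suc k)" for c
    using z by (intro summable_mult) (simp add: summable_Suc_iff summable_geometric)
  have AE: "AE \<theta> in upper_arc. summable (\<lambda>k. norm (f k \<theta>))"
    using bound by (intro AE_I2 summable_comparison_test'[OF summ[of B]]) auto
  have s: "summable (\<lambda>k. \<integral>\<theta>. norm (f k \<theta>) \<partial>upper_arc)"
  proof (rule summable_comparison_test'[OF summ[of "pi * B"]])
    fix k :: nat
    have "(\<integral>\<theta>. norm (f k \<theta>) \<partial>upper_arc) \<le> (\<integral>\<theta>. B * norm z ^ Suc k \<partial>upper_arc)"
      using bound int by (intro integral_mono) auto
    then show "norm (\<integral>\<theta>. norm (f k \<theta>) \<partial>upper_arc) \<le> pi * B * norm z ^ Suc k"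
      by (simp add: measure_upper_arc)
  qed
  have suminf: "(\<Sum>k. f k \<theta>) = of_real (h \<theta>) * cos_kernel z \<theta>" for \<theta>
    using sums_mult[OF cos_kernel_sums[OF z], of "of_real (h \<theta>)" \<theta>]
    by (simp add: f_def sums_iff mult.assoc)
  have eq: "integral\<^sup>L upper_arc (f k) =
      of_real (\<integral>\<theta>. h \<theta> * cos (real (Suc k) * \<theta>) \<partial>upper_arc) * z ^ Suc k" for k
    unfolding f_def using integrable_mult_cos
    by (simp only: integral_mult_left_zero integral_complex_of_real)
  show "integrable upper_arc (\<lambda>\<theta>. of_real (h \<theta>) * cos_kernel z \<theta>)"
    using integrable_suminf[OF int AE s] by (simp add: suminf)
  show "(\<lambda>k. of_real (\<integral>\<theta>. h \<theta> * cos (real (Suc k) * \<theta>) \<partial>upper_arc) * z ^ Suc k) sums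
      (\<integral>\<theta>. of_real (h \<theta>) * cos_kernel z \<theta> \<partial>upper_arc)"
    using sums_integral[OF int AE s] by (simp only: suminf eq)
qed

lemma cos_transform_sums:
  assumes "norm z < 1"
  shows "(\<lambda>k. of_real (2 / pi * (\<integral>\<theta>. h \<theta> * cos (real (Suc k) * \<theta>) \<partial>upper_arc)) * z ^ Suc k) sums
    cos_transform h z"
  using sums_mult[OF cos_kernel_integral(2)[OF assms], of "2 / pi"]
  by (simp add: cos_transform_def mult.assoc)

lemma cos_transform_0: "cos_transform h 0 = 0"
proof -
  have "(\<lambda>k. 0) sums cos_transform h 0"
    using cos_transform_sums[of 0] by simp
  then show ?thesis
    by (simp add: sums_iff)
qed

lemma holomorphic_cos_transform: "cos_transform h holomorphic_on ball 0 1"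
proof -
  define c where "c k = complex_of_real (2 / pi * (\<integral>\<theta>. h \<theta> * cos (real k * \<theta>) \<partial>upper_arc))" for k
  show ?thesis
  \<comment> \<open>The rule expects a series from exponent 0, so a zero constant coefficient is put
    in front.\<close>
  proof (rule power_series_holomorphic[where a = "\<lambda>k. if k = 0 then 0 else c k"])
    fix w :: complex assume "w \<in> ball 0 1"
    then have "(\<lambda>k. c (Suc k) * w ^ Suc k) sums cos_transform h w"
      unfolding c_def by (intro cos_transform_sums) simp
    then show "(\<lambda>k. (if k = 0 then 0 else c k) * (w - 0) ^ k) sums cos_transform h w"
      using sums_Suc_iff[of "\<lambda>k. (if k = 0 then 0 else c k) * w ^ k" "cos_transform h w"] by simp
  qed
qed

end

text \<open>The series expansion for the constant function 1 has only zero coefficients, as every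
  \<open>cos (real (Suc k) * \<theta>)\<close> has integral 0 over the arc.\<close>

lemma integral_Re_cos_kernel:
  assumes "norm z < 1"
  shows "integrable upper_arc (\<lambda>\<theta>. Re (cos_kernel z \<theta>))" "(\<integral>\<theta>. Re (cos_kernel z \<theta>) \<partial>upper_arc) = 0"
proof -
  have cos0: "(\<integral>\<theta>. cos (real (Suc k) * \<theta>) \<partial>upper_arc) = 0" for k
    using sin_npi[of "Suc k"] integral_cos[of "real (Suc k)" 0 pi]
    by (simp add: LBINT_eq_integral_upper_arc[symmetric] zero_ereal_def del: of_nat_Suc sin_npi)
  have int: "integrable upper_arc (cos_kernel z)"
    using cos_kernel_integral(1)[of "\<lambda>_. 1" 1, OF _ _ assms] by simp
  have "(\<lambda>k. 0) sums (\<integral>\<theta>. cos_kernel z \<theta> \<partial>upper_arc)"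
    using cos_kernel_integral(2)[of "\<lambda>_. 1" 1, OF _ _ assms] by (simp add: cos0 del: of_nat_Suc)
  then have "(\<integral>\<theta>. cos_kernel z \<theta> \<partial>upper_arc) = 0"
    by (simp add: sums_iff)
  then show "integrable upper_arc (\<lambda>\<theta>. Re (cos_kernel z \<theta>))" "(\<integral>\<theta>. Re (cos_kernel z \<theta>) \<partial>upper_arc) = 0"
    using int by (simp_all add: integral_Re)
qed

text \<open>The lower bound -1/2 is exactly what gives \<open>\<bar>x\<bar> \<le> x + 1\<close> for
  the real part \<open>x\<close> of the kernel. The majorant \<open>x + 1\<close> has integral
  \<open>pi\<close>, which the factor \<open>2 / pi\<close> turns into 2.\<close>

lemma Re_cos_transform_bound:
  assumes h: "h \<in> borel_measurable upper_arc" "\<And>\<theta>. \<theta> \<in> {0<..<pi} \<Longrightarrow> \<bar>h \<theta>\<bar> \<le> B"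
    and z: "norm z < 1"
  shows "\<bar>Re (cos_transform h z)\<bar> \<le> 2 * B"
proof -
  note K = integral_Re_cos_kernel[OF z]
  note int = cos_kernel_integral(1)[OF h z]
  have "Re (cos_transform h z) = 2 / pi * (\<integral>\<theta>. h \<theta> * Re (cos_kernel z \<theta>) \<partial>upper_arc)"
    using int integral_Re[OF int] by (simp add: cos_transform_def)
  also have "\<bar>\<dots>\<bar> \<le> 2 / pi * (\<integral>\<theta>. B * (Re (cos_kernel z \<theta>) + 1) \<partial>upper_arc)"
  proof -
    have "norm (\<integral>\<theta>. h \<theta> * Re (cos_kernel z \<theta>) \<partial>upper_arc) \<le> (\<integral>\<theta>. B * (Re (cos_kernel z \<theta>) + 1) \<partial>upper_arc)"
    proof (unfold real_norm_def, rule integral_abs_bound_integral)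
      show "integrable upper_arc (\<lambda>\<theta>. h \<theta> * Re (cos_kernel z \<theta>))"
        using integrable_Re[OF int] by simp
      show "integrable upper_arc (\<lambda>\<theta>. B * (Re (cos_kernel z \<theta>) + 1))"
        using K(1) by auto
      fix \<theta> assume "\<theta> \<in> space upper_arc"
      then have "\<bar>h \<theta>\<bar> \<le> B"
        using h by simp
      moreover have "\<bar>Re (cos_kernel z \<theta>)\<bar> \<le> Re (cos_kernel z \<theta>) + 1"
        using Re_cos_kernel_ge[OF z, of \<theta>] by auto
      ultimately show "\<bar>h \<theta> * Re (cos_kernel z \<theta>)\<bar> \<le> B * (Re (cos_kernel z \<theta>) + 1)"
        by (auto simp: abs_mult intro!: mult_mono)
    qed
    then show ?thesis
      by (simp add: abs_mult divide_right_mono)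
  qed
  also have "\<dots> = 2 * B"
    using K by (simp add: measure_upper_arc)
  finally show ?thesis .
qed

section \<open>Hardy norms of functions with bounded real part\<close>

text \<open>Cauchy's integral formula at the centre, written out in the angle; the degenerate circle
  \<open>r = 0\<close> is treated directly.\<close>

lemma circle_mean_value:
  fixes f :: "complex \<Rightarrow> complex"
  assumes hol: "f holomorphic_on ball 0 1" and r: "0 \<le> r" "r < 1"
  shows "(LBINT \<theta>=0..2*pi. f (of_real r * exp (\<i> * of_real \<theta>))) = 2 * pi * f 0"
proof -
  have cont: "continuous_on {0..2*pi} (\<lambda>\<theta>. f (of_real r * cis \<theta>))"
    by (rule continuous_on_compose2[OF holomorphic_on_imp_continuous_on[OF hol]])
      (use r in \<open>auto intro!: continuous_intros simp: norm_mult\<close>)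
  have "((\<lambda>\<theta>. f (of_real r * cis \<theta>)) has_integral 2 * pi * f 0) {0..2*pi}"
  proof (cases "r = 0")
    case True
    then show ?thesis
      using has_integral_const_real[of "f 0" 0 "2 * pi"] by (simp add: scaleR_conv_of_real)
  next
    case False
    then have "((\<lambda>u. f u / (u - 0)) has_contour_integral (2 * of_real pi * \<i> * f 0)) (circlepath 0 r)"
      using r by (intro Cauchy_integral_circlepath_simple holomorphic_on_subset[OF hol]) auto
    then have "((\<lambda>t. f (r * cis t) / (r * cis t) * r * \<i> * cis t) has_integral (2 * pi * \<i> * f 0)) {0..2*pi}"
      by (simp add: circlepath_def has_contour_integral_part_circlepath_iff)
    then have "((\<lambda>t. \<i> * f (r * cis t)) has_integral (2 * pi * \<i> * f 0)) {0..2*pi}"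
      using False by (simp add: mult.commute)
    \<comment> \<open>Multiplication by \<open>-\<i>\<close> removes the factor \<open>\<i>\<close>
      left by the derivative of the parametrisation.\<close>
    from has_integral_mult_right[OF this, of "-\<i>"]
    have "((\<lambda>t. - \<i> * (\<i> * f (r * cis t))) has_integral - \<i> * (2 * pi * \<i> * f 0)) {0..2*pi}" .
    moreover have "- \<i> * (\<i> * w) = w" "- \<i> * (2 * pi * \<i> * w) = 2 * pi * w" for w :: complex
      by (simp_all add: complex_eq_iff)
    ultimately show ?thesis
      by (simp only:)
  qed
  moreover have "(LBINT \<theta>=0..2*pi. f (of_real r * cis \<theta>)) = integral {0..2*pi} (\<lambda>\<theta>. f (of_real r * cis \<theta>))"
    unfolding zero_ereal_def using borel_integrable_atLeastAtMost'[OF cont]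
    by (intro interval_integral_eq_integral) auto
  ultimately show ?thesis
    by (simp add: integral_unique cis_conv_exp)
qed

text \<open>This is \<open>t \<le> exp t\<close> at \<open>t = x / p\<close>, raised to the power
  \<open>p\<close>.\<close>

lemma powr_le_exp:
  assumes "p > 0" "x \<ge> (0::real)"
  shows "x powr p \<le> p powr p * exp x"
proof -
  have "x / p \<le> exp (x / p)"
    using exp_ge_add_one_self[of "x / p"] by linarith
  then have "x \<le> p * exp (x / p)"
    using assms by (simp add: field_simps)
  then have "x powr p \<le> (p * exp (x / p)) powr p"
    using assms by (intro powr_mono2) auto
  also have "\<dots> = p powr p * exp x"
    using assms by (simp add: powr_mult exp_powr_real)
  finally show ?thesis .
qed

text \<open>A function holomorphic in \<open>w\<close> whose real part dominates \<open>norm w powr p\<close> on the strip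
  \<open>\<bar>Re w\<bar> \<le> 1\<close> reduces the \<open>p\<close>-th circular means to the mean value property.\<close>

lemma norm_powr_le_Re_cos:
  assumes "p > 0" "\<bar>Re w\<bar> \<le> 1"
  shows "norm w powr p \<le> 4 * exp 1 * p powr p * Re (cos w)"
proof -
  have "norm w \<le> 1 + \<bar>Im w\<bar>"
    using cmod_le[of w] assms by linarith
  then have "exp (norm w) \<le> exp 1 * exp \<bar>Im w\<bar>"
    by (simp add: exp_add[symmetric])
  also have "exp \<bar>Im w\<bar> \<le> exp (Im w) + exp (- Im w)"
    by (auto simp: abs_if)
  \<comment> \<open>Since \<open>1 < pi / 3\<close>, the cosine of \<open>Re w\<close> is at least
    1/2. The right side is a multiple of \<open>Re (cos w)\<close>, which equals
    \<open>cos (Re w)\<close> times the hyperbolic cosine of \<open>Im w\<close>.\<close>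
  also have "\<dots> \<le> 2 * cos (Re w) * (exp (Im w) + exp (- Im w))"
  proof -
    have "cos (pi / 3) \<le> cos \<bar>Re w\<bar>"
      using assms pi_gt3 by (intro cos_monotone_0_pi_le) auto
    then have "1 \<le> 2 * cos (Re w)"
      by (simp add: cos_60)
    then show ?thesis
      using mult_right_mono[of 1 "2 * cos (Re w)" "exp (Im w) + exp (- Im w)"] by simp
  qed
  also have "\<dots> = 4 * Re (cos w)"
    by (simp add: Re_cos)
  finally have le: "exp (norm w) \<le> 4 * exp 1 * Re (cos w)"
    by simp
  have "norm w powr p \<le> p powr p * exp (norm w)"
    using assms by (intro powr_le_exp) auto
  also have "\<dots> \<le> p powr p * (4 * exp 1 * Re (cos w))"
    using le by (intro mult_left_mono) auto
  finally show ?thesis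
    by (simp add: mult_ac)
qed

text \<open>Division by \<open>\<eta>\<close> brings the values of \<open>f\<close> into the strip
  \<open>\<bar>Re w\<bar> \<le> 1\<close>. There \<open>norm w powr p\<close> is dominated by a
  multiple of \<open>Re (cos w)\<close>, whose circular means do not depend on
  \<open>r\<close>.\<close>

lemma hardy_norm_le:
  assumes hol: "f holomorphic_on ball 0 1" and f0: "f 0 = 0"
    and Re_f: "\<And>z. norm z < 1 \<Longrightarrow> \<bar>Re (f z)\<bar> \<le> \<eta>" and "\<eta> > 0" "p > 0"
  shows "hardy_norm p f \<le> ennreal ((4 * exp 1) powr (1 / p) * p * \<eta>)"
  unfolding hardy_norm_def
proof (rule SUP_least, rule ennreal_leI)
  fix r :: real assume "r \<in> {0..<1}"
  then have r: "0 \<le> r" "r < 1"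
    by auto
  let ?e = "\<lambda>\<theta>. of_real r * exp (\<i> * of_real \<theta>) :: complex"
  \<comment> \<open>The constant of \<open>norm_powr_le_Re_cos\<close>, times
    \<open>\<eta> powr p\<close> to undo the rescaling.\<close>
  define C where "C = 4 * exp 1 * p powr p * \<eta> powr p"
  define F where "F z = of_real C * cos (f z / of_real \<eta>)" for z
  have F: "F holomorphic_on ball 0 1"
    unfolding F_def using \<open>\<eta> > 0\<close> by (intro holomorphic_intros hol) auto
  have e: "?e \<theta> \<in> ball 0 1" for \<theta>
    using r by (simp add: norm_mult)
  have cont: "continuous_on {0..2*pi} (\<lambda>\<theta>. g (?e \<theta>))" if "g holomorphic_on ball 0 1" for g
    by (rule continuous_on_compose2[OF holomorphic_on_imp_continuous_on[OF that]])
      (use e in \<open>auto intro!: continuous_intros\<close>)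
  have int: "set_integrable lborel {0..2*pi} (\<lambda>\<theta>. norm (f (?e \<theta>)) powr p)"
    using \<open>p > 0\<close> by (intro borel_integrable_atLeastAtMost' continuous_on_powr' continuous_intros cont hol) auto
  have intF: "set_integrable lborel {0..2*pi} (\<lambda>\<theta>. F (?e \<theta>))"
    by (intro borel_integrable_atLeastAtMost' cont F)
  have le: "norm (f z) powr p \<le> Re (F z)" if "z \<in> ball 0 1" for z
  proof -
    have "norm (f z / of_real \<eta>) powr p \<le> 4 * exp 1 * p powr p * Re (cos (f z / of_real \<eta>))"
      using Re_f[of z] that \<open>\<eta> > 0\<close> \<open>p > 0\<close> by (intro norm_powr_le_Re_cos) auto
    then show ?thesis
      using \<open>\<eta> > 0\<close> by (simp add: F_def C_def norm_divide powr_divide field_simps)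
  qed
  have "(LBINT \<theta>=0..2*pi. norm (f (?e \<theta>)) powr p) = (LBINT \<theta>:{0..2*pi}. norm (f (?e \<theta>)) powr p)"
    unfolding zero_ereal_def by (intro interval_integral_Icc) auto
  also have "\<dots> \<le> (LBINT \<theta>:{0..2*pi}. Re (F (?e \<theta>)))"
    using le[OF e] int intF by (intro set_integral_mono) (auto simp: set_integrable_def dest: integrable_Re)
  also have "\<dots> = Re (LBINT \<theta>:{0..2*pi}. F (?e \<theta>))"
    using integral_Re[of lborel "\<lambda>\<theta>. indicator {0..2*pi} \<theta> *\<^sub>R F (?e \<theta>)"] intF by (simp add: set_lebesgue_integral_def set_integrable_def)
  also have "(LBINT \<theta>:{0..2*pi}. F (?e \<theta>)) = (LBINT \<theta>=0..2*pi. F (?e \<theta>))"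
    unfolding zero_ereal_def by (intro interval_integral_Icc[symmetric]) auto
  also have "\<dots> = 2 * pi * F 0"
    by (rule circle_mean_value[OF F r])
  \<comment> \<open>As \<open>f 0 = 0\<close> and \<open>cos 0 = 1\<close>, the value
    \<open>F 0\<close> is \<open>C\<close>.\<close>
  finally have "(LBINT \<theta>=0..2*pi. norm (f (?e \<theta>)) powr p) \<le> 2 * pi * C"
    by (simp add: F_def f0)
  moreover have "0 \<le> (LBINT \<theta>=0..2*pi. norm (f (?e \<theta>)) powr p)"
    unfolding zero_ereal_def by (subst interval_integral_Icc) (auto simp: set_lebesgue_integral_def)
  ultimately have "(1 / (2 * pi) * (LBINT \<theta>=0..2*pi. norm (f (?e \<theta>)) powr p)) powr (1 / p) \<le> C powr (1 / p)"
    using \<open>p > 0\<close> by (intro powr_mono2) (auto simp: field_simps)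
  also have "\<dots> = (4 * exp 1) powr (1 / p) * p * \<eta>"
    using \<open>p > 0\<close> \<open>\<eta> > 0\<close> by (simp add: C_def powr_mult powr_powr)
  finally show "(1 / (2 * pi) * (LBINT \<theta>=0..2*pi. norm (f (?e \<theta>)) powr p)) powr (1 / p)
      \<le> (4 * exp 1) powr (1 / p) * p * \<eta>" .
qed

section \<open>Gross' construction\<close>

text \<open>The quantile function is monotone and takes values in \<open>{a..b}\<close>, so the
  results on bounded functions apply to it.\<close>

lemma gross_eq_cos_transform:
  assumes "\<forall>x<a. cdf M x = 0" "1 \<le> cdf M b"
  defines "q \<equiv> \<lambda>\<theta>. quantile M (\<theta> / pi)"
  shows "q \<in> borel_measurable upper_arc"
    and "\<And>\<theta>. \<theta> \<in> {0<..<pi} \<Longrightarrow> \<bar>q \<theta>\<bar> \<le> max \<bar>a\<bar> \<bar>b\<bar>"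
    and "\<And>z. norm z < 1 \<Longrightarrow> gross M z = cos_transform q z"
proof -
  have "mono_on {0<..<pi} q"
    using mono_onD[OF quantile_mono_on[OF assms(1,2)]]
    by (intro mono_onI) (auto simp: q_def divide_right_mono)
  then show meas: "q \<in> borel_measurable upper_arc"
    using borel_measurable_mono_on_fnc measurable_cong_sets[OF sets_upper_arc refl] by blast
  show bound: "\<bar>q \<theta>\<bar> \<le> max \<bar>a\<bar> \<bar>b\<bar>" if "\<theta> \<in> {0<..<pi}" for \<theta>
    using quantile_in_interval[OF assms(1,2), of "\<theta> / pi"] that by (auto simp: q_def)
  show "gross M z = cos_transform q z" if "norm z < 1" for z
    using cos_transform_sums[OF meas bound that]
    by (simp add: gross_def gross_coeff_def LBINT_eq_integral_upper_arc q_def sums_iff)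
qed

theorem corollary16:
  fixes \<mu> :: "real measure" and a b p :: real
  assumes "real_distribution \<mu>"
    and "a < b"
    and "measure_support \<mu> = {a..b}"
    and "finite (atoms \<mu>)"
    and "p > 1"
  shows "(\<forall>\<^sub>F n in sequentially.
            hardy_norm p (\<lambda>z. gross (discretize a b n \<mu>) z - gross \<mu> z) < \<infinity>) \<and>
         (\<lambda>n. enn2real (hardy_norm p (\<lambda>z. gross (discretize a b n \<mu>) z - gross \<mu> z)))
            \<in> O(\<lambda>n. 1 / real n)"
proof -
  interpret real_distribution \<mu>
    by fact
  \<comment> \<open>The bound of \<open>hardy_norm_le\<close> for
    \<open>\<eta> = 2 * (b - a) / real n\<close>, with \<open>1 / real n\<close> taken out.\<close>
  define K where "K = (4 * exp 1) powr (1 / p) * p * (2 * (b - a))"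
  have bound: "hardy_norm p (\<lambda>z. gross (discretize a b n \<mu>) z - gross \<mu> z) \<le> ennreal (K * (1 / real n))"
    if n: "n > 0" for n
  proof -
    define d where "d = (b - a) / real n"
    have d: "d > 0"
      using n assms by (simp add: d_def)
    let ?\<nu> = "discretize a b n \<mu>"
    note disc = cdf_discretize_bounds[OF assms(2) n, folded d_def]
    have \<mu>: "\<forall>x<a. cdf \<mu> x = 0"
      using assms by (intro allI impI cdf_eq_0_below_support[of a]) auto
    have \<mu>b: "1 \<le> cdf \<mu> b"
      using assms cdf_eq_1_above_support[of b b] by simp
    have \<nu>: "\<forall>x<a. cdf ?\<nu> x = 0"
    proof (intro allI impI antisym)
      show "cdf ?\<nu> x \<le> 0" if "x < a" for x
        using disc(1)[of x] \<mu> assms that by simp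
      show "0 \<le> cdf ?\<nu> x" for x
        by (simp add: cdf_def)
    qed
    have "mesh a b n k \<le> b" if "k \<le> n" for k
      using that n assms mult_left_mono[of "real k / real n" 1 "b - a"] by (simp add: mesh_def)
    \<comment> \<open>All mesh points lie in \<open>{..b}\<close>, so the telescoping runs up to the
      last index \<open>n\<close>.\<close>
    then have "cdf ?\<nu> b = cdf \<mu> (mesh a b n n)"
      using assms n by (intro cdf_discretize) auto
    then have \<nu>b: "1 \<le> cdf ?\<nu> b"
      using \<mu>b n by (simp add: mesh_def)
    note g = gross_eq_cos_transform[OF \<mu> \<mu>b]
    note g' = gross_eq_cos_transform[OF \<nu> \<nu>b]
    define h where "h \<theta> = quantile ?\<nu> (\<theta> / pi) - quantile \<mu> (\<theta> / pi)" for \<theta>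
    have h_meas: "h \<in> borel_measurable upper_arc"
      unfolding h_def using g(1) g'(1) by measurable
    have h_bound: "\<bar>h \<theta>\<bar> \<le> d" if "\<theta> \<in> {0<..<pi}" for \<theta>
      using quantile_shift_bounds[OF \<mu> \<mu>b \<nu> \<nu>b disc, of "\<theta> / pi"] that assms
      by (auto simp: h_def)
    \<comment> \<open>Linearity of the integral, valid because both quantile functions are
      bounded.\<close>
    have diff: "gross ?\<nu> z - gross \<mu> z = cos_transform h z" if "norm z < 1" for z
      using that cos_kernel_integral(1)[OF g(1,2) that] cos_kernel_integral(1)[OF g'(1,2) that]
      by (simp add: g(3) g'(3) cos_transform_def h_def ring_distribs)
    have "hardy_norm p (\<lambda>z. gross ?\<nu> z - gross \<mu> z) \<le> ennreal ((4 * exp 1) powr (1 / p) * p * (2 * d))"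
    proof (rule hardy_norm_le)
      show "(\<lambda>z. gross ?\<nu> z - gross \<mu> z) holomorphic_on ball 0 1"
        using holomorphic_cos_transform[OF h_meas h_bound] diff
        by (subst holomorphic_cong[OF refl, of _ _ "cos_transform h"]) auto
      show "gross ?\<nu> 0 - gross \<mu> 0 = 0"
        using diff[of 0] cos_transform_0[OF h_meas h_bound] by simp
      show "\<bar>Re (gross ?\<nu> z - gross \<mu> z)\<bar> \<le> 2 * d" if "norm z < 1" for z
        using diff[OF that] Re_cos_transform_bound[OF h_meas h_bound that] by simp
    qed (use d assms in auto)
    then show ?thesis
      by (simp add: K_def d_def)
  qed
  have "K \<ge> 0"
    using assms by (simp add: K_def)
  show ?thesis
  proof
    \<comment> \<open>Finiteness is recorded separately because \<open>enn2real\<close> sends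
      \<open>\<infinity>\<close> to 0.\<close>
    show "\<forall>\<^sub>F n in sequentially. hardy_norm p (\<lambda>z. gross (discretize a b n \<mu>) z - gross \<mu> z) < \<infinity>"
      using eventually_gt_at_top[of 0]
    proof eventually_elim
      case (elim n)
      then show ?case
        using bound[OF elim] le_less_trans ennreal_less_top by fastforce
    qed
    show "(\<lambda>n. enn2real (hardy_norm p (\<lambda>z. gross (discretize a b n \<mu>) z - gross \<mu> z)))
        \<in> O(\<lambda>n. 1 / real n)"
    proof (rule bigoI[where c = K])
      show "\<forall>\<^sub>F n in sequentially. norm (enn2real (hardy_norm p
          (\<lambda>z. gross (discretize a b n \<mu>) z - gross \<mu> z))) \<le> K * norm (1 / real n)"
        using eventually_gt_at_top[of 0]
      proof eventually_elim
        case (elim n)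
        then show ?case
          using enn2real_mono[OF bound[OF elim]] \<open>K \<ge> 0\<close> by simp
      qed
    qed
  qed
qed

end
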